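(* Let $0<\theta<1$, $2\le q\le\infty$ and let $d^k:[0,1)\to[0,\infty)$, $k=0,1,2$, be measurable functions. Assume that $$\frac1\alpha(1-t)^{k/2}d^k(t)\le d^0(t)\le\alpha\left(\int_t^1[d^1(s)]^2\,ds\right)^{1/2}\qquad\text{for }t\in[0,1)\text{ and }k=1,2,$$ and that $$d^1(t)\le A+\alpha\left(\int_0^t[d^2(u)]^2\,du\right)^{1/2}\qquad\text{for }t\in[0,1)$$ for some $A\ge0$ and $\alpha>0$. Then there is a constant $c\ge1$ depending at most on $(\alpha,\theta,q)$ such that, with $L_q=L_q\left([0,1),\frac{dt}{1-t}\right)$, $$\frac1c\left\|(1-t)^{-\theta/2}d^0(t)\right\|_{L_q}\le\left\|(1-t)^{(1-\theta)/2}d^1(t)\right\|_{L_q}\le c\left\|(1-t)^{-\theta/2}d^0(t)\right\|_{L_q}$$ and $$\left\|(1-t)^{(2-\theta)/2}d^2(t)\right\|_{L_q}\le c\left\|(1-t)^{-\theta/2}d^0(t)\right\|_{L_q}\le c^2\left[A+\left\|(1-t)^{(2-\theta)/2}d^2(t)\right\|_{L_q}\right].$$ If the functions $d^1$ and $d^2$ are nondecreasing, then the inequalities are true for $1\le q<2$ as well.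
   Context: Here $d^k$ denotes a function indexed by the superscript $k$ (not a power). Norms and integrals are allowed to take the value $+\infty$. *)

theory Defs
  imports "HOL-Analysis.Analysis" "HOL-Probability.Essential_Supremum"
begin

text \<open>Norms and integrals may be infinite, so they take values in \<^typ>\<open>ennreal\<close>. The power
  below is only meant for exponents \<open>p > 0\<close>, with the convention \<open>\<infinity>\<^sup>p = \<infinity>\<close>.\<close>

definition ennpowr :: "ennreal \<Rightarrow> real \<Rightarrow> ennreal" where
  "ennpowr x p = (if x = \<infinity> then \<infinity> else ennreal (enn2real x powr p))"

definition Lq_norm :: "'a measure \<Rightarrow> ennreal \<Rightarrow> ('a \<Rightarrow> real) \<Rightarrow> ennreal" where
  "Lq_norm M q f =
    (if q = \<infinity> then esssup M (\<lambda>x. ennreal \<bar>f x\<bar>)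
     else ennpowr (\<integral>\<^sup>+ x. ennreal (\<bar>f x\<bar> powr enn2real q) \<partial>M) (1 / enn2real q))"

definition mu :: "real measure" where
  "mu = density (lebesgue_on {0..<1}) (\<lambda>t. ennreal (1 / (1 - t)))"

text \<open>The functions \<open>d\<^sup>0, d\<^sup>1, d\<^sup>2\<close> on \<open>[0,1)\<close> are \<open>d 0\<close>, \<open>d 1\<close>, \<open>d 2\<close>; no condition here or
  below sees other indices or the values outside \<open>[0,1)\<close>.\<close>

definition admissible :: "real \<Rightarrow> real \<Rightarrow> (nat \<Rightarrow> real \<Rightarrow> real) \<Rightarrow> bool" where
  "admissible \<alpha> A d \<longleftrightarrow>
    (\<forall>k\<in>{0,1,2}. d k \<in> borel_measurable (lebesgue_on {0..<1})) \<and>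
    (\<forall>k\<in>{0,1,2}. \<forall>t\<in>{0..<1}. 0 \<le> d k t) \<and>
    (\<forall>t\<in>{0..<1}. \<forall>k\<in>{1,2}. 1 / \<alpha> * (1 - t) powr (real k / 2) * d k t \<le> d 0 t) \<and>
    (\<forall>t\<in>{0..<1}. ennreal (d 0 t) \<le>
       ennreal \<alpha> * ennpowr (\<integral>\<^sup>+ s\<in>{t..<1}. ennreal ((d 1 s)\<^sup>2) \<partial>lebesgue) (1 / 2)) \<and>
    (\<forall>t\<in>{0..<1}. ennreal (d 1 t) \<le>
       ennreal A + ennreal \<alpha> * ennpowr (\<integral>\<^sup>+ u\<in>{0..t}. ennreal ((d 2 u)\<^sup>2) \<partial>lebesgue) (1 / 2))"

definition wnorm :: "real \<Rightarrow> ennreal \<Rightarrow> nat \<Rightarrow> (real \<Rightarrow> real) \<Rightarrow> ennreal" where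
  "wnorm \<theta> q k f = Lq_norm mu q (\<lambda>t. (1 - t) powr ((real k - \<theta>) / 2) * f t)"

definition norm_inequalities ::
    "real \<Rightarrow> ennreal \<Rightarrow> real \<Rightarrow> real \<Rightarrow> (nat \<Rightarrow> real \<Rightarrow> real) \<Rightarrow> bool" where
  "norm_inequalities \<theta> q c A d \<longleftrightarrow>
    ennreal (1 / c) * wnorm \<theta> q 0 (d 0) \<le> wnorm \<theta> q 1 (d 1) \<and>
    wnorm \<theta> q 1 (d 1) \<le> ennreal c * wnorm \<theta> q 0 (d 0) \<and>
    wnorm \<theta> q 2 (d 2) \<le> ennreal c * wnorm \<theta> q 0 (d 0) \<and>
    ennreal c * wnorm \<theta> q 0 (d 0) \<le> ennreal (c\<^sup>2) * (ennreal A + wnorm \<theta> q 2 (d 2))"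

end

theory Submission
  imports Defs
begin

text \<open>The estimates of the norms of \<open>d 1\<close> and \<open>d 2\<close> by the norm of \<open>d 0\<close> are pointwise. The two converse
  estimates are weighted Hardy inequalities: after squaring, the weights turn the integral of
  \<open>(d 1)\<^sup>2\<close> over \<open>[t, 1)\<close>, and that of \<open>(d 2)\<^sup>2\<close> over \<open>[0, t]\<close>, into an integral operator over the
  dilation invariant measure \<open>dt / (1 - t)\<close>, acting on the square of the weighted function, with kernel
  \<open>((1 - s) / (1 - t)) powr \<theta>\<close> on \<open>s \<ge> t\<close>, respectively the transpose of such a kernel with
  \<open>1 - \<theta>\<close> in place of \<open>\<theta>\<close>. Since \<open>0 < \<theta> < 1\<close>, both marginals of both kernels are bounded
  (\<open>oriented_kernel_integrals\<close>), as in Schur's test.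

  For \<open>2 \<le> q < \<infinity>\<close> Jensen's inequality with exponent \<open>q / 2\<close> (\<open>powr_nn_integral_le\<close>) moves the power inside
  the kernel integral, and Tonelli's theorem (\<open>Lq_norm_kernel_le\<close>) then gives the norm bound; for
  \<open>q = \<infinity>\<close> the marginal bound is enough. For \<open>q < 2\<close> the exponent \<open>p = q / 2\<close> is below \<open>1\<close>, and the power is
  moved inside by interpolating between the supremum and the integral of the \<open>p\<close>-th power of the
  integrand (\<open>powr_nn_integral_le_of_sup\<close>). The supremum is under control for monotone functions: a
  value at \<open>s\<close> bounds the function from below on the interval from \<open>s\<close> to \<open>(1 + s) / 2\<close>, whose mass is at
  least \<open>1 / 2\<close> (\<open>mu_right_half_interval\<close>), while weight and kernel change there only by bounded factors.

  The additive constant \<open>A\<close> contributes the norm of the weight \<open>(1 - t) powr ((1 - \<theta>) / 2)\<close>, which is finite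
  (\<open>Lq_norm_weight\<close>).\<close>

section \<open>The measure and the Hardy kernel\<close>

lemma space_mu [simp]: "space mu = {0..<1}"
  by (simp add: mu_def)

lemma borel_measurable_mu_iff: "f \<in> borel_measurable mu \<longleftrightarrow> f \<in> borel_measurable (lebesgue_on {0..<1})"
  by (simp add: mu_def)

lemma borel_imp_measurable_mu:
  assumes "f \<in> borel_measurable borel"
  shows "f \<in> borel_measurable mu"
  unfolding borel_measurable_mu_iff
  using assms by (intro measurable_restrict_space1 measurable_completion) simp

lemma ident_measurable_mu: "(\<lambda>x. x) \<in> measurable mu (borel :: real measure)"
  by (rule borel_imp_measurable_mu) simp

lemma nn_integral_mu:
  fixes h :: "real \<Rightarrow> ennreal"
  assumes "h \<in> borel_measurable mu"
  shows "(\<integral>\<^sup>+ s. h s \<partial>mu) = (\<integral>\<^sup>+ s. ennreal (1 / (1 - s)) * h s * indicator {0..<1} s \<partial>lebesgue)"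
proof -
  have h: "h \<in> borel_measurable (lebesgue_on {0..<1})"
    using assms by (simp add: borel_measurable_mu_iff)
  have w: "(\<lambda>t. ennreal (1 / (1 - t))) \<in> borel_measurable (lebesgue_on {0..<1::real})"
    by (intro measurable_restrict_space1 measurable_completion) simp
  have "(\<integral>\<^sup>+ s. h s \<partial>mu) = (\<integral>\<^sup>+ s. ennreal (1 / (1 - s)) * h s \<partial>lebesgue_on {0..<1})"
    unfolding mu_def by (rule nn_integral_density[OF w h])
  also have "\<dots> = (\<integral>\<^sup>+ s. ennreal (1 / (1 - s)) * h s * indicator {0..<1} s \<partial>lebesgue)"
    by (rule nn_integral_restrict_space) simp
  finally show ?thesis .
qed

lemma sigma_finite_mu: "sigma_finite_measure mu"
proof -
  interpret finite_measure "lebesgue_on {0..<1::real}"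
    by (intro finite_measure_lebesgue_on bounded_set_imp_lmeasurable) auto
  have w: "(\<lambda>t. ennreal (1 / (1 - t))) \<in> borel_measurable (lebesgue_on {0..<1::real})"
    by (intro measurable_restrict_space1 measurable_completion) simp
  show ?thesis
    unfolding mu_def using sigma_finite_iff_density_finite[OF w] by simp
qed

text \<open>The substitution \<open>y = 1 - s\<close> moves the singular end point to \<open>0\<close>, where the integrals of
  powers are standard.\<close>

lemma nn_integral_mu_reflect:
  fixes g :: "real \<Rightarrow> real"
  assumes [measurable]: "g \<in> borel_measurable borel"
  shows "(\<integral>\<^sup>+ s. ennreal (g (1 - s)) \<partial>mu) =
    (\<integral>\<^sup>+ y. ennreal (1 / y) * ennreal (g y) * indicator {0<..1} y \<partial>lborel)"
proof -
  have "(\<integral>\<^sup>+ s. ennreal (g (1 - s)) \<partial>mu) =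
      (\<integral>\<^sup>+ s. ennreal (1 / (1 - s)) * ennreal (g (1 - s)) * indicator {0..<1} s \<partial>lborel)"
    by (subst nn_integral_mu) (auto simp: nn_integral_completion intro!: borel_imp_measurable_mu)
  also have "\<dots> = (\<integral>\<^sup>+ y. ennreal (1 / y) * ennreal (g y) * indicator {0..<1} (1 - y) \<partial>lborel)"
    by (subst nn_integral_real_affine[where c = "-1" and t = 1]) auto
  also have "\<dots> = (\<integral>\<^sup>+ y. ennreal (1 / y) * ennreal (g y) * indicator {0<..1} y \<partial>lborel)"
    by (intro nn_integral_cong) (auto simp: indicator_def)
  finally show ?thesis .
qed

text \<open>With \<open>\<kappa> = 1\<close> the kernel lives on \<open>s \<ge> t\<close>. The value \<open>\<kappa> = 2\<close> leaves room for replacing a point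
  \<open>s\<close> by any point up to the midpoint of \<open>[s, 1]\<close> without leaving the support, in either order of
  the two arguments.\<close>

definition hardy_kernel :: "real \<Rightarrow> real \<Rightarrow> real \<Rightarrow> real \<Rightarrow> real" where
  "hardy_kernel \<kappa> \<beta> t s = (if 1 - s \<le> \<kappa> * (1 - t) then ((1 - s) / (1 - t)) powr \<beta> else 0)"

lemma hardy_kernel_nonneg: "0 \<le> hardy_kernel \<kappa> \<beta> t s"
  by (simp add: hardy_kernel_def)

text \<open>The kernel is homogeneous of degree \<open>0\<close> in \<open>(1 - t, 1 - s)\<close> and \<open>mu\<close> is the invariant measure of the
  dilations, so both marginals are bounded uniformly; this is what makes Schur's test applicable.\<close>

lemma hardy_kernel_integral_right:
  assumes "0 < \<beta>" "0 < \<kappa>" "t < 1"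
  shows "(\<integral>\<^sup>+ s. ennreal (hardy_kernel \<kappa> \<beta> t s) \<partial>mu) \<le> ennreal (\<kappa> powr \<beta> / \<beta>)"
proof -
  define b where "b = 1 - t"
  have b: "b > 0" using assms b_def by simp
  define g where "g = (\<lambda>y. if y \<le> \<kappa> * b then (y / b) powr \<beta> else 0)"
  have [measurable]: "g \<in> borel_measurable borel" unfolding g_def by measurable
  have "(\<integral>\<^sup>+ s. ennreal (hardy_kernel \<kappa> \<beta> t s) \<partial>mu) = (\<integral>\<^sup>+ s. ennreal (g (1 - s)) \<partial>mu)"
    by (simp only: hardy_kernel_def g_def b_def)
  also have "\<dots> = (\<integral>\<^sup>+ y. ennreal (1 / y) * ennreal (g y) * indicator {0<..1} y \<partial>lborel)"
    by (rule nn_integral_mu_reflect) measurable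
  also have "\<dots> \<le> (\<integral>\<^sup>+ y. ennreal (b powr - \<beta>) * (indicator {0..\<kappa> * b} y * ennreal (y powr (\<beta> - 1))) \<partial>lborel)"
  proof (intro nn_integral_mono)
    fix y :: real
    have "1 / y * (y / b) powr \<beta> = b powr - \<beta> * y powr (\<beta> - 1)" if "0 < y"
      using that b by (simp add: powr_divide powr_diff powr_minus field_simps)
    then show "ennreal (1 / y) * ennreal (g y) * indicator {0<..1} y \<le>
       ennreal (b powr - \<beta>) * (indicator {0..\<kappa> * b} y * ennreal (y powr (\<beta> - 1)))"
      by (auto simp: indicator_def g_def ennreal_mult[symmetric])
  qed
  also have "\<dots> = ennreal (b powr - \<beta>) * (\<integral>\<^sup>+ y. indicator {0..\<kappa> * b} y * ennreal (y powr (\<beta> - 1)) \<partial>lborel)"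
    by (rule nn_integral_cmult) measurable
  also have "(\<integral>\<^sup>+ y. indicator {0..\<kappa> * b} y * ennreal (y powr (\<beta> - 1)) \<partial>lborel) = ennreal ((\<kappa> * b) powr \<beta> / \<beta>)"
    using nn_integral_has_integral_lebesgue[OF _ has_integral_powr_from_0[of "\<beta> - 1" "\<kappa> * b"]] assms b
    by (simp add: ennreal_mult ennreal_indicator)
  also have "ennreal (b powr - \<beta>) * ennreal ((\<kappa> * b) powr \<beta> / \<beta>) = ennreal (\<kappa> powr \<beta> / \<beta>)"
    using assms b by (simp add: ennreal_mult[symmetric] powr_mult powr_minus field_simps)
  finally show ?thesis .
qed

lemma hardy_kernel_integral_left:
  assumes "0 < \<beta>" "0 < \<kappa>" "s < 1"
  shows "(\<integral>\<^sup>+ t. ennreal (hardy_kernel \<kappa> \<beta> t s) \<partial>mu) \<le> ennreal (\<kappa> powr \<beta> / \<beta>)"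
proof -
  define a where "a = 1 - s"
  have a: "a > 0" using assms a_def by simp
  define g where "g = (\<lambda>y. if a \<le> \<kappa> * y then (a / y) powr \<beta> else 0)"
  have [measurable]: "g \<in> borel_measurable borel" unfolding g_def by measurable
  have "(\<integral>\<^sup>+ t. ennreal (hardy_kernel \<kappa> \<beta> t s) \<partial>mu) = (\<integral>\<^sup>+ t. ennreal (g (1 - t)) \<partial>mu)"
    by (simp only: hardy_kernel_def g_def a_def)
  also have "\<dots> = (\<integral>\<^sup>+ y. ennreal (1 / y) * ennreal (g y) * indicator {0<..1} y \<partial>lborel)"
    by (rule nn_integral_mu_reflect) measurable
  also have "\<dots> \<le> (\<integral>\<^sup>+ y. ennreal (a powr \<beta>) * (indicator {a / \<kappa>..} y * ennreal (y powr (- \<beta> - 1))) \<partial>lborel)"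
  proof (intro nn_integral_mono)
    fix y :: real
    have "1 / y * (a / y) powr \<beta> = a powr \<beta> * y powr (- \<beta> - 1)" if "0 < y"
      using that a by (simp add: powr_divide powr_diff powr_minus field_simps)
    then show "ennreal (1 / y) * ennreal (g y) * indicator {0<..1} y \<le>
       ennreal (a powr \<beta>) * (indicator {a / \<kappa>..} y * ennreal (y powr (- \<beta> - 1)))"
      using assms by (auto simp: indicator_def g_def ennreal_mult[symmetric] field_simps)
  qed
  also have "\<dots> = ennreal (a powr \<beta>) * (\<integral>\<^sup>+ y. indicator {a / \<kappa>..} y * ennreal (y powr (- \<beta> - 1)) \<partial>lborel)"
    by (rule nn_integral_cmult) measurable
  also have "(\<integral>\<^sup>+ y. indicator {a / \<kappa>..} y * ennreal (y powr (- \<beta> - 1)) \<partial>lborel) = ennreal ((a / \<kappa>) powr - \<beta> / \<beta>)"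
    using nn_integral_has_integral_lebesgue[OF _ has_integral_powr_to_inf[of "- \<beta> - 1" "a / \<kappa>"]] assms a
    by (simp add: ennreal_mult ennreal_indicator)
  also have "ennreal (a powr \<beta>) * ennreal ((a / \<kappa>) powr - \<beta> / \<beta>) = ennreal (\<kappa> powr \<beta> / \<beta>)"
    using assms a by (simp add: ennreal_mult[symmetric] powr_divide powr_minus field_simps)
  finally show ?thesis .
qed

section \<open>Norms with possibly infinite values\<close>

lemma ennpowr_mono: "0 \<le> p \<Longrightarrow> x \<le> y \<Longrightarrow> ennpowr x p \<le> ennpowr y p"
  by (cases x; cases y) (auto simp: ennpowr_def top_unique intro!: ennreal_leI powr_mono2)

lemma ennpowr_ennreal: "0 \<le> x \<Longrightarrow> ennpowr (ennreal x) p = ennreal (x powr p)"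
  by (simp add: ennpowr_def)

lemma ennpowr_cmult: "0 < C \<Longrightarrow> ennpowr (ennreal C * x) p = ennreal (C powr p) * ennpowr x p"
proof (cases x)
  case (real r)
  assume "0 < C"
  then show ?thesis using real
    by (simp add: ennreal_mult[symmetric] ennpowr_ennreal powr_mult)
next
  case top
  assume "0 < C"
  then show ?thesis using top
    by (simp add: ennpowr_def ennreal_mult_top)
qed

lemma ennpowr_add_le:
  assumes "0 \<le> p" "p \<le> 1"
  shows "ennpowr (x + y) p \<le> ennreal 2 * (ennpowr x p + ennpowr y p)"
proof -
  have "ennpowr (x + y) p \<le> ennpowr (ennreal 2 * max x y) p"
    using assms by (intro ennpowr_mono) (auto simp: mult_2 intro!: add_mono)
  also have "\<dots> = ennreal (2 powr p) * ennpowr (max x y) p"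
    by (rule ennpowr_cmult) simp
  also have "\<dots> \<le> ennreal 2 * (ennpowr x p + ennpowr y p)"
    using assms powr_mono[of p 1 2]
    by (intro mult_mono ennreal_leI) (auto simp: max_def)
  finally show ?thesis .
qed

lemma Lq_norm_ennreal:
  "0 < p \<Longrightarrow> Lq_norm M (ennreal p) f = ennpowr (\<integral>\<^sup>+ x. ennreal (\<bar>f x\<bar> powr p) \<partial>M) (1 / p)"
  by (simp add: Lq_norm_def)

lemma Lq_norm_leI:
  assumes "0 < p" "0 < C"
    and "(\<integral>\<^sup>+ x. ennreal (\<bar>f x\<bar> powr p) \<partial>M) \<le> ennreal C * (\<integral>\<^sup>+ x. ennreal (\<bar>g x\<bar> powr p) \<partial>M)"
  shows "Lq_norm M (ennreal p) f \<le> ennreal (C powr (1 / p)) * Lq_norm M (ennreal p) g"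
  using ennpowr_mono[OF _ assms(3), of "1 / p"] assms(1,2)
  by (simp add: Lq_norm_ennreal ennpowr_cmult)

text \<open>A triangle inequality up to a constant, from \<open>a + b \<le> 2 max a b\<close>.\<close>

lemma Lq_norm_add_le:
  assumes "1 \<le> q" and [measurable]: "f \<in> borel_measurable M" "g \<in> borel_measurable M" "h \<in> borel_measurable M"
    and le: "\<And>x. x \<in> space M \<Longrightarrow> \<bar>f x\<bar> \<le> \<bar>g x\<bar> + \<bar>h x\<bar>"
  shows "Lq_norm M q f \<le> ennreal 4 * (Lq_norm M q g + Lq_norm M q h)"
proof (cases q)
  case top
  have "AE x in M. ennreal \<bar>f x\<bar> \<le> esssup M (\<lambda>x. ennreal \<bar>g x\<bar>) + esssup M (\<lambda>x. ennreal \<bar>h x\<bar>)"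
    using esssup_AE[of "\<lambda>x. ennreal \<bar>g x\<bar>" M] esssup_AE[of "\<lambda>x. ennreal \<bar>h x\<bar>" M] AE_space
  proof eventually_elim
    case (elim x)
    have "ennreal \<bar>f x\<bar> \<le> ennreal \<bar>g x\<bar> + ennreal \<bar>h x\<bar>"
      using le[OF elim(3)] by (simp add: ennreal_plus[symmetric] ennreal_leI del: ennreal_plus)
    also have "\<dots> \<le> esssup M (\<lambda>x. ennreal \<bar>g x\<bar>) + esssup M (\<lambda>x. ennreal \<bar>h x\<bar>)"
      using elim by (intro add_mono) auto
    finally show ?case .
  qed
  then have "Lq_norm M q f \<le> 1 * (Lq_norm M q g + Lq_norm M q h)"
    by (auto simp: Lq_norm_def top intro!: esssup_I)
  also have "\<dots> \<le> ennreal 4 * (Lq_norm M q g + Lq_norm M q h)"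
    by (intro mult_right_mono) auto
  finally show ?thesis .
next
  case (real p)
  then have p: "1 \<le> p" using assms(1) by simp
  let ?I = "\<lambda>f. \<integral>\<^sup>+ x. ennreal (\<bar>f x\<bar> powr p) \<partial>M"
  have "?I f \<le> (\<integral>\<^sup>+ x. ennreal (2 powr p) * (ennreal (\<bar>g x\<bar> powr p) + ennreal (\<bar>h x\<bar> powr p)) \<partial>M)"
  proof (intro nn_integral_mono)
    fix x assume "x \<in> space M"
    have "\<bar>f x\<bar> powr p \<le> (2 * max \<bar>g x\<bar> \<bar>h x\<bar>) powr p"
      using le[OF \<open>x \<in> space M\<close>] p by (intro powr_mono2) auto
    also have "\<dots> \<le> 2 powr p * (\<bar>g x\<bar> powr p + \<bar>h x\<bar> powr p)"
      by (simp add: powr_mult max_def)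
    finally show "ennreal (\<bar>f x\<bar> powr p) \<le> ennreal (2 powr p) * (ennreal (\<bar>g x\<bar> powr p) + ennreal (\<bar>h x\<bar> powr p))"
      by (simp add: ennreal_plus[symmetric] ennreal_mult[symmetric] ennreal_leI del: ennreal_plus)
  qed
  also have "\<dots> = ennreal (2 powr p) * (?I g + ?I h)"
    by (subst nn_integral_cmult) (auto simp: nn_integral_add)
  finally have "ennpowr (?I f) (1 / p) \<le> ennpowr (ennreal (2 powr p) * (?I g + ?I h)) (1 / p)"
    using p by (intro ennpowr_mono) auto
  also have "\<dots> = ennreal 2 * ennpowr (?I g + ?I h) (1 / p)"
    using p by (subst ennpowr_cmult) (auto simp: powr_powr)
  also have "\<dots> \<le> ennreal 2 * (ennreal 2 * (ennpowr (?I g) (1 / p) + ennpowr (?I h) (1 / p)))"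
    using p by (intro mult_left_mono ennpowr_add_le) auto
  also have "\<dots> = ennreal 4 * (ennpowr (?I g) (1 / p) + ennpowr (?I h) (1 / p))"
    by (simp add: mult.assoc[symmetric] ennreal_mult[symmetric] del: ennreal_numeral)
  finally show ?thesis
    using p real by (simp add: Lq_norm_ennreal)
qed

lemma Lq_norm_mult_le:
  assumes "1 \<le> q" "0 < a" and [measurable]: "f \<in> borel_measurable M" "g \<in> borel_measurable M"
    and le: "\<And>x. x \<in> space M \<Longrightarrow> \<bar>f x\<bar> \<le> a * \<bar>g x\<bar>"
  shows "Lq_norm M q f \<le> ennreal a * Lq_norm M q g"
proof (cases q)
  case top
  have "AE x in M. ennreal \<bar>f x\<bar> \<le> ennreal a * esssup M (\<lambda>x. ennreal \<bar>g x\<bar>)"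
    using esssup_AE[of "\<lambda>x. ennreal \<bar>g x\<bar>" M] AE_space
  proof eventually_elim
    case (elim x)
    have "ennreal \<bar>f x\<bar> \<le> ennreal a * ennreal \<bar>g x\<bar>"
      using le[OF elim(2)] assms(2) by (simp add: ennreal_mult[symmetric] ennreal_leI)
    also have "\<dots> \<le> ennreal a * esssup M (\<lambda>x. ennreal \<bar>g x\<bar>)"
      using elim by (intro mult_left_mono) auto
    finally show ?case .
  qed
  then show ?thesis
    by (auto simp: Lq_norm_def top intro!: esssup_I)
next
  case (real p)
  then have p: "1 \<le> p" using assms(1) by simp
  have "(\<integral>\<^sup>+ x. ennreal (\<bar>f x\<bar> powr p) \<partial>M) \<le> (\<integral>\<^sup>+ x. ennreal (a powr p) * ennreal (\<bar>g x\<bar> powr p) \<partial>M)"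
  proof (intro nn_integral_mono)
    fix x assume "x \<in> space M"
    have "\<bar>f x\<bar> powr p \<le> (a * \<bar>g x\<bar>) powr p"
      using le[OF \<open>x \<in> space M\<close>] p by (intro powr_mono2) auto
    then show "ennreal (\<bar>f x\<bar> powr p) \<le> ennreal (a powr p) * ennreal (\<bar>g x\<bar> powr p)"
      using assms(2) by (simp add: powr_mult ennreal_mult[symmetric] ennreal_leI)
  qed
  also have "\<dots> = ennreal (a powr p) * (\<integral>\<^sup>+ x. ennreal (\<bar>g x\<bar> powr p) \<partial>M)"
    by (rule nn_integral_cmult) measurable
  finally show ?thesis
    using Lq_norm_leI[of p "a powr p" M f g] p real assms(2) by (simp add: powr_powr)
qed

section \<open>Powers of kernel integrals\<close>

text \<open>Jensen's inequality up to a constant. For every level \<open>l > 0\<close> one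
  has \<open>G \<le> l + l powr (1 - p) * G powr p\<close>. Integrating against \<open>K\<close> bounds \<open>x\<close> by \<open>l * C\<close> plus a multiple
  of the integral on the right, and the level \<open>l = x / (2 * C)\<close> lets half of \<open>x\<close> absorb the first term.\<close>

lemma powr_nn_integral_le:
  fixes K G :: "'a \<Rightarrow> real"
  assumes p: "1 \<le> p" and C: "0 < C" and x: "0 \<le> x"
    and [measurable]: "K \<in> borel_measurable M" "G \<in> borel_measurable M"
    and K: "\<And>s. s \<in> space M \<Longrightarrow> 0 \<le> K s" and G: "\<And>s. s \<in> space M \<Longrightarrow> 0 \<le> G s"
    and mass: "(\<integral>\<^sup>+ s. ennreal (K s) \<partial>M) \<le> ennreal C"
    and le: "ennreal x \<le> (\<integral>\<^sup>+ s. ennreal (K s * G s) \<partial>M)"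
  shows "ennreal (x powr p) \<le> ennreal (2 * (2 * C) powr (p - 1)) * (\<integral>\<^sup>+ s. ennreal (K s * G s powr p) \<partial>M)"
proof (cases "x = 0")
  case True
  then show ?thesis by simp
next
  case False
  then have x: "0 < x" using x by simp
  define l where "l = x / (2 * C)"
  have l: "0 < l" using x C by (simp add: l_def)
  define J where "J = (\<integral>\<^sup>+ s. ennreal (K s * G s powr p) \<partial>M)"
  \<comment> \<open>Below the level the first term suffices, above it the power dominates since \<open>p \<ge> 1\<close>.\<close>
  have split: "G s \<le> l + l powr (1 - p) * G s powr p" if "s \<in> space M" for s
  proof (cases "G s \<le> l")
    case True
    have "0 \<le> l powr (1 - p) * G s powr p" by simp
    then show ?thesis using True by linarith
  next
    case False
    then have g: "0 < G s" "l \<le> G s" using l by auto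
    have "1 \<le> (G s / l) powr (p - 1)"
      using g l p by (intro ge_one_powr_ge_zero) auto
    then have "G s \<le> G s * (G s / l) powr (p - 1)"
      using g by simp
    also have "\<dots> = l powr (1 - p) * G s powr p"
      using g l by (simp add: powr_divide powr_diff field_simps)
    finally show ?thesis using l by linarith
  qed
  have "ennreal x \<le> (\<integral>\<^sup>+ s. ennreal (K s * G s) \<partial>M)" by (rule le)
  also have "\<dots> \<le> (\<integral>\<^sup>+ s. ennreal l * ennreal (K s) + ennreal (l powr (1 - p)) * ennreal (K s * G s powr p) \<partial>M)"
  proof (intro nn_integral_mono)
    fix s assume s: "s \<in> space M"
    have "K s * G s \<le> K s * (l + l powr (1 - p) * G s powr p)"
      using split[OF s] K[OF s] by (rule mult_left_mono)
    then show "ennreal (K s * G s) \<le> ennreal l * ennreal (K s) + ennreal (l powr (1 - p)) * ennreal (K s * G s powr p)"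
      using l K[OF s]
      by (simp add: ennreal_plus[symmetric] ennreal_mult[symmetric] ennreal_leI algebra_simps del: ennreal_plus)
  qed
  also have "\<dots> = ennreal l * (\<integral>\<^sup>+ s. ennreal (K s) \<partial>M) + ennreal (l powr (1 - p)) * J"
    unfolding J_def by (subst nn_integral_add) (auto simp: nn_integral_cmult)
  also have "\<dots> \<le> ennreal l * ennreal C + ennreal (l powr (1 - p)) * J"
    by (intro add_mono mult_left_mono mass) auto
  also have "ennreal l * ennreal C = ennreal (x / 2)"
    using l C by (simp add: l_def ennreal_mult[symmetric])
  finally have main: "ennreal x \<le> ennreal (x / 2) + ennreal (l powr (1 - p)) * J" .
  show ?thesis
  proof (cases J)
    case top
    then show ?thesis using C unfolding J_def[symmetric] by (simp add: ennreal_mult_top)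
  next
    case (real j)
    have "x \<le> x / 2 + l powr (1 - p) * j"
      using main real x by (simp add: ennreal_plus[symmetric] ennreal_mult[symmetric] del: ennreal_plus)
    then have "x / 2 \<le> l powr (1 - p) * j" by simp
    then have "x / 2 * (2 * l powr (p - 1)) \<le> l powr (1 - p) * j * (2 * l powr (p - 1))"
      by (rule mult_right_mono) simp
    also have "\<dots> = 2 * j"
      using l by (simp add: powr_diff field_simps)
    finally have *: "x * l powr (p - 1) \<le> 2 * j" by simp
    have "x powr p = x * l powr (p - 1) * (2 * C) powr (p - 1)"
      using x C by (simp add: l_def powr_divide powr_diff field_simps)
    also have "\<dots> \<le> 2 * j * (2 * C) powr (p - 1)"
      using * by (rule mult_right_mono) simp
    finally have "x powr p \<le> 2 * (2 * C) powr (p - 1) * j"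
      by (simp add: mult_ac)
    then show ?thesis
      using real C unfolding J_def[symmetric] by (simp add: ennreal_mult[symmetric] ennreal_leI)
  qed
qed

text \<open>For exponents below \<open>1\<close> Jensen's inequality has the wrong direction. As with the embedding of \<open>\<ell>\<^sup>p\<close>
  into \<open>\<ell>\<^sup>1\<close>, the missing factor \<open>H powr (1 - p)\<close> is bounded by the supremum of \<open>H\<close>; so a bound for the
  supremum of \<open>H powr p\<close> by the quantity \<open>S\<close> that also bounds its integral is enough.\<close>

lemma powr_nn_integral_le_of_sup:
  fixes H :: "'a \<Rightarrow> real"
  assumes p: "0 < p" "p < 1" and x: "0 \<le> x"
    and [measurable]: "H \<in> borel_measurable M"
    and H: "\<And>s. s \<in> space M \<Longrightarrow> 0 \<le> H s"
    and sup: "\<And>s. s \<in> space M \<Longrightarrow> ennreal (H s powr p) \<le> S"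
    and int: "(\<integral>\<^sup>+ s. ennreal (H s powr p) \<partial>M) \<le> S"
    and le: "ennreal x \<le> (\<integral>\<^sup>+ s. ennreal (H s) \<partial>M)"
  shows "ennreal (x powr p) \<le> S"
proof (cases S)
  case top
  then show ?thesis by simp
next
  case (real r)
  define m where "m = r powr (1 / p - 1)"
  have "ennreal x \<le> (\<integral>\<^sup>+ s. ennreal (H s) \<partial>M)" by (rule le)
  also have "\<dots> \<le> (\<integral>\<^sup>+ s. ennreal m * ennreal (H s powr p) \<partial>M)"
  proof (intro nn_integral_mono)
    fix s assume s: "s \<in> space M"
    have b: "H s powr p \<le> r"
      using sup[OF s] real by simp
    have "H s = (H s powr p) powr (1 / p - 1) * H s powr p"
      using p H[OF s] by (cases "H s = 0") (simp_all add: powr_powr powr_add[symmetric] algebra_simps)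
    also have "\<dots> \<le> m * H s powr p"
      unfolding m_def using b p by (intro mult_right_mono powr_mono2) auto
    finally show "ennreal (H s) \<le> ennreal m * ennreal (H s powr p)"
      by (simp add: ennreal_mult[symmetric] ennreal_leI m_def)
  qed
  also have "\<dots> = ennreal m * (\<integral>\<^sup>+ s. ennreal (H s powr p) \<partial>M)"
    by (rule nn_integral_cmult) measurable
  also have "\<dots> \<le> ennreal m * ennreal r"
    using int real by (intro mult_left_mono) auto
  finally have "x \<le> m * r"
    using real by (simp add: ennreal_mult[symmetric] m_def)
  then have "x powr p \<le> (m * r) powr p"
    using x p by (intro powr_mono2) auto
  also have "\<dots> = r"
    using real p by (cases "r = 0") (simp_all add: m_def powr_mult powr_powr powr_add[symmetric] algebra_simps)
  finally show ?thesis
    using real by (simp add: ennreal_leI)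
qed

text \<open>The Tonelli half of Schur's test: a pointwise bound of the \<open>q\<close>-th power by a kernel integral of the
  \<open>q\<close>-th power becomes a norm bound as soon as the kernel is integrable in its first variable,
  uniformly in the second.\<close>

lemma Lq_norm_kernel_le:
  fixes L :: "real \<Rightarrow> real \<Rightarrow> real"
  assumes q: "0 < q" and C: "0 < C" and D: "0 < D"
    and [measurable]: "(\<lambda>x. L (fst x) (snd x)) \<in> borel_measurable (borel \<Otimes>\<^sub>M borel)"
    and L: "\<And>t s. 0 \<le> L t s"
    and mass: "\<And>s. s \<in> {0..<1} \<Longrightarrow> (\<integral>\<^sup>+ t. ennreal (L t s) \<partial>mu) \<le> ennreal C"
    and [measurable]: "u \<in> borel_measurable mu" "F \<in> borel_measurable mu"
    and le: "\<And>t. t \<in> {0..<1} \<Longrightarrow>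
      ennreal (\<bar>u t\<bar> powr q) \<le> ennreal D * (\<integral>\<^sup>+ s. ennreal (L t s * \<bar>F s\<bar> powr q) \<partial>mu)"
  shows "Lq_norm mu (ennreal q) u \<le> ennreal ((D * C) powr (1 / q)) * Lq_norm mu (ennreal q) F"
proof (rule Lq_norm_leI[OF q])
  show "0 < D * C" using C D by simp
  interpret sigma_finite_measure mu by (rule sigma_finite_mu)
  interpret pair_sigma_finite mu mu ..
  note [measurable] = ident_measurable_mu
  have L1 [measurable]: "(\<lambda>x. L (fst x) (snd x)) \<in> borel_measurable (mu \<Otimes>\<^sub>M mu)"
  proof -
    have "(\<lambda>x. (fst x, snd x)) \<in> measurable (mu \<Otimes>\<^sub>M mu) (borel \<Otimes>\<^sub>M borel)"
      by measurable
    from measurable_compose[OF this assms(4)] show ?thesis by simp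
  qed
  have L2 [measurable]: "(\<lambda>t. L t s) \<in> borel_measurable mu" for s
  proof (rule borel_imp_measurable_mu)
    have "(\<lambda>t. (t, s)) \<in> measurable borel (borel \<Otimes>\<^sub>M borel)"
      by measurable
    from measurable_compose[OF this assms(4)] show "(\<lambda>t. L t s) \<in> borel_measurable borel"
      by simp
  qed
  have "(\<integral>\<^sup>+ t. ennreal (\<bar>u t\<bar> powr q) \<partial>mu) \<le>
      (\<integral>\<^sup>+ t. ennreal D * (\<integral>\<^sup>+ s. ennreal (L t s * \<bar>F s\<bar> powr q) \<partial>mu) \<partial>mu)"
    using le by (intro nn_integral_mono) auto
  also have "\<dots> = ennreal D * (\<integral>\<^sup>+ t. (\<integral>\<^sup>+ s. ennreal (L t s * \<bar>F s\<bar> powr q) \<partial>mu) \<partial>mu)"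
    by (rule nn_integral_cmult) measurable
  also have "(\<integral>\<^sup>+ t. (\<integral>\<^sup>+ s. ennreal (L t s * \<bar>F s\<bar> powr q) \<partial>mu) \<partial>mu) =
      (\<integral>\<^sup>+ s. (\<integral>\<^sup>+ t. ennreal (L t s * \<bar>F s\<bar> powr q) \<partial>mu) \<partial>mu)"
    by (rule Fubini'[symmetric]) measurable
  also have "\<dots> = (\<integral>\<^sup>+ s. (\<integral>\<^sup>+ t. ennreal (L t s) \<partial>mu) * ennreal (\<bar>F s\<bar> powr q) \<partial>mu)"
    by (intro nn_integral_cong) (simp add: ennreal_mult L nn_integral_multc)
  also have "\<dots> \<le> (\<integral>\<^sup>+ s. ennreal C * ennreal (\<bar>F s\<bar> powr q) \<partial>mu)"
    using mass by (intro nn_integral_mono mult_right_mono) auto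
  also have "\<dots> = ennreal C * (\<integral>\<^sup>+ s. ennreal (\<bar>F s\<bar> powr q) \<partial>mu)"
    by (rule nn_integral_cmult) measurable
  finally have "(\<integral>\<^sup>+ t. ennreal (\<bar>u t\<bar> powr q) \<partial>mu) \<le>
      ennreal D * (ennreal C * (\<integral>\<^sup>+ s. ennreal (\<bar>F s\<bar> powr q) \<partial>mu))"
    by (simp add: mult_left_mono)
  then show "(\<integral>\<^sup>+ t. ennreal (\<bar>u t\<bar> powr q) \<partial>mu) \<le>
      ennreal (D * C) * (\<integral>\<^sup>+ s. ennreal (\<bar>F s\<bar> powr q) \<partial>mu)"
    using C D by (simp add: ennreal_mult mult.assoc)
qed

text \<open>Intervals reaching from \<open>s\<close> halfway to \<open>1\<close> have \<open>mu\<close>-mass bounded below, so a value that is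
  dominated on such an interval is dominated by an integral.\<close>

lemma mu_right_half_interval:
  assumes "0 \<le> s" "s < 1"
  shows "ennreal (1 / 2) \<le> (\<integral>\<^sup>+ r. indicator {s..(1 + s) / 2} r \<partial>mu)"
proof -
  have "ennreal (1 / 2) = ennreal (1 / (1 - s)) * emeasure lborel {s..(1 + s) / 2}"
    using assms by (simp add: ennreal_mult[symmetric] field_simps)
  also have "\<dots> = (\<integral>\<^sup>+ r. ennreal (1 / (1 - s)) * indicator {s..(1 + s) / 2} r \<partial>lborel)"
    by (subst nn_integral_cmult_indicator) auto
  also have "\<dots> \<le> (\<integral>\<^sup>+ r. ennreal (1 / (1 - r)) * indicator {s..(1 + s) / 2} r * indicator {0..<1} r \<partial>lborel)"
    using assms by (intro nn_integral_mono) (auto simp: indicator_def field_simps intro!: ennreal_leI)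
  also have "\<dots> = (\<integral>\<^sup>+ r. indicator {s..(1 + s) / 2} r \<partial>mu)"
    by (subst nn_integral_mu) (auto simp: nn_integral_completion intro!: borel_imp_measurable_mu)
  finally show ?thesis .
qed

section \<open>Hardy inequalities\<close>

text \<open>The Hardy operator integrating over \<open>[t, 1)\<close> and the one integrating over \<open>[0, t]\<close> have the same
  kernel up to transposition and a change of \<open>\<beta>\<close>; the flag selects the orientation, so that both are
  treated at once.\<close>

definition oriented_kernel :: "bool \<Rightarrow> real \<Rightarrow> real \<Rightarrow> real \<Rightarrow> real \<Rightarrow> real" where
  "oriented_kernel up \<kappa> \<beta> t s = (if up then hardy_kernel \<kappa> \<beta> t s else hardy_kernel \<kappa> \<beta> s t)"

lemma oriented_kernel_nonneg: "0 \<le> oriented_kernel up \<kappa> \<beta> t s"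
  by (simp add: oriented_kernel_def hardy_kernel_nonneg)

lemma oriented_kernel_measurable:
  "(\<lambda>x. oriented_kernel up \<kappa> \<beta> (fst x) (snd x)) \<in> borel_measurable (borel \<Otimes>\<^sub>M borel)"
  unfolding oriented_kernel_def hardy_kernel_def by measurable

lemma oriented_kernel_measurable_mu [measurable]:
  "oriented_kernel up \<kappa> \<beta> t \<in> borel_measurable mu"
  unfolding oriented_kernel_def hardy_kernel_def
  by (intro borel_imp_measurable_mu) measurable

lemma oriented_kernel_integrals:
  assumes "0 < \<beta>" "0 < \<kappa>"
  shows "t < 1 \<Longrightarrow> (\<integral>\<^sup>+ s. ennreal (oriented_kernel up \<kappa> \<beta> t s) \<partial>mu) \<le> ennreal (\<kappa> powr \<beta> / \<beta>)"
    and "s < 1 \<Longrightarrow> (\<integral>\<^sup>+ t. ennreal (oriented_kernel up \<kappa> \<beta> t s) \<partial>mu) \<le> ennreal (\<kappa> powr \<beta> / \<beta>)"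
  using hardy_kernel_integral_left[OF assms] hardy_kernel_integral_right[OF assms]
  by (cases up; simp add: oriented_kernel_def)+

lemma square_powr_half: "(x\<^sup>2) powr (q / 2) = \<bar>x\<bar> powr q" for x q :: real
proof -
  have "(x\<^sup>2) powr (q / 2) = (\<bar>x\<bar> powr 2) powr (q / 2)"
    by (cases "x = 0") (simp_all add: powr_numeral)
  also have "\<dots> = \<bar>x\<bar> powr q"
    by (subst powr_powr) simp
  finally show ?thesis .
qed

text \<open>The functions enter squared, so the exponent acting on the kernel integral is \<open>q / 2 \<ge> 1\<close> and Jensen's
  inequality applies.\<close>

lemma hardy_ge_2:
  assumes \<beta>: "0 < \<beta>" and q: "2 \<le> q"
    and [measurable]: "u \<in> borel_measurable mu" "F \<in> borel_measurable mu"
    and le: "\<And>t. t \<in> {0..<1} \<Longrightarrow>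
      ennreal ((u t)\<^sup>2) \<le> (\<integral>\<^sup>+ s. ennreal (oriented_kernel up 1 \<beta> t s * (F s)\<^sup>2) \<partial>mu)"
  shows "Lq_norm mu (ennreal q) u \<le>
    ennreal ((2 * (2 * (1 / \<beta>)) powr (q / 2 - 1) * (1 / \<beta>)) powr (1 / q)) * Lq_norm mu (ennreal q) F"
proof (rule Lq_norm_kernel_le[where L = "oriented_kernel up 1 \<beta>"])
  fix t :: real assume t: "t \<in> {0..<1}"
  have "ennreal (((u t)\<^sup>2) powr (q / 2)) \<le> ennreal (2 * (2 * (1 / \<beta>)) powr (q / 2 - 1)) *
      (\<integral>\<^sup>+ s. ennreal (oriented_kernel up 1 \<beta> t s * ((F s)\<^sup>2) powr (q / 2)) \<partial>mu)"
    using q \<beta> t oriented_kernel_integrals(1)[OF \<beta>, of 1 t up]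
    by (intro powr_nn_integral_le le) (auto simp: oriented_kernel_nonneg)
  then show "ennreal (\<bar>u t\<bar> powr q) \<le> ennreal (2 * (2 * (1 / \<beta>)) powr (q / 2 - 1)) *
      (\<integral>\<^sup>+ s. ennreal (oriented_kernel up 1 \<beta> t s * \<bar>F s\<bar> powr q) \<partial>mu)"
    by (simp only: square_powr_half)
next
  fix s :: real assume "s \<in> {0..<1}"
  then show "(\<integral>\<^sup>+ t. ennreal (oriented_kernel up 1 \<beta> t s) \<partial>mu) \<le> ennreal (1 / \<beta>)"
    using oriented_kernel_integrals(2)[OF \<beta>, of 1 s up] by simp
qed (use q \<beta> in \<open>auto simp: oriented_kernel_nonneg oriented_kernel_measurable\<close>)

text \<open>Moving the second argument from \<open>s\<close> to a point \<open>r\<close> at most halfway towards \<open>1\<close> changes the ratio in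
  the kernel by at most a factor \<open>2\<close>. In the transposed case \<open>r\<close> may pass \<open>t\<close>, which is why the
  right-hand side has the wider support \<open>\<kappa> = 2\<close>.\<close>

lemma oriented_kernel_shift:
  assumes "t < 1" "s \<le> r" "r < 1" "1 - s \<le> 2 * (1 - r)" and \<beta>: "0 < \<beta>" and p: "0 < p"
  shows "oriented_kernel up 1 \<beta> t s powr p \<le> 2 powr (\<beta> * p) * oriented_kernel up 2 (\<beta> * p) t r"
proof (cases up)
  case True
  have "((1 - s) / (1 - t)) powr (\<beta> * p) \<le> (2 * ((1 - r) / (1 - t))) powr (\<beta> * p)"
    using assms divide_right_mono[of "1 - s" "2 * (1 - r)" "1 - t"] by (intro powr_mono2) auto
  also have "\<dots> = 2 powr (\<beta> * p) * ((1 - r) / (1 - t)) powr (\<beta> * p)"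
    using assms by (subst powr_mult) auto
  finally show ?thesis
    using assms True by (simp add: oriented_kernel_def hardy_kernel_def powr_powr)
next
  case False
  have "((1 - t) / (1 - s)) powr (\<beta> * p) \<le> ((1 - t) / (1 - r)) powr (\<beta> * p)"
    using assms by (intro powr_mono2 divide_left_mono) auto
  also have "\<dots> \<le> 2 powr (\<beta> * p) * ((1 - t) / (1 - r)) powr (\<beta> * p)"
    using \<beta> p mult_right_mono[of 1 "2 powr (\<beta> * p)" "((1 - t) / (1 - r)) powr (\<beta> * p)"]
    by (simp add: ge_one_powr_ge_zero)
  finally show ?thesis
    using assms False by (simp add: oriented_kernel_def hardy_kernel_def powr_powr)
qed

text \<open>Here \<open>p = q / 2 < 1\<close> and some regularity of \<open>F\<close> is indispensable, since an \<open>L\<^sup>1\<close> norm is not controlled by an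
  \<open>L\<^sup>p\<close> norm in general. The doubling hypothesis provides the supremum bound required by
  \<open>powr_nn_integral_le_of_sup\<close>: the value of \<open>(K F\<^sup>2)\<^sup>p\<close> at \<open>s\<close> is dominated throughout the interval from
  \<open>s\<close> to \<open>(1 + s) / 2\<close>, whose mass is at least \<open>1 / 2\<close>.\<close>

lemma hardy_less_2:
  fixes \<beta> q :: real
  defines "p \<equiv> q / 2"
  defines "E \<equiv> 2 powr (\<beta> * p) * 2 powr q"
  assumes \<beta>: "0 < \<beta>" and q: "0 < q" "q < 2"
    and [measurable]: "u \<in> borel_measurable mu" "F \<in> borel_measurable mu"
    and F: "\<And>s. s \<in> {0..<1} \<Longrightarrow> 0 \<le> F s"
    and reg: "\<And>s r. \<lbrakk>0 \<le> s; s \<le> r; r < 1; 1 - s \<le> 2 * (1 - r)\<rbrakk> \<Longrightarrow> F s \<le> 2 * F r"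
    and le: "\<And>t. t \<in> {0..<1} \<Longrightarrow>
      ennreal ((u t)\<^sup>2) \<le> (\<integral>\<^sup>+ s. ennreal (oriented_kernel up 1 \<beta> t s * (F s)\<^sup>2) \<partial>mu)"
  shows "Lq_norm mu (ennreal q) u \<le>
    ennreal ((2 * E * (2 powr (\<beta> * p) / (\<beta> * p))) powr (1 / q)) * Lq_norm mu (ennreal q) F"
proof (rule Lq_norm_kernel_le[where L = "oriented_kernel up 2 (\<beta> * p)"])
  have p: "0 < p" "p < 1" using q by (auto simp: p_def)
  have E: "0 < E" by (simp add: E_def)
  show "0 < q" "0 < 2 * E" "0 < 2 powr (\<beta> * p) / (\<beta> * p)" using q E \<beta> p by auto
  fix t :: real assume t: "t \<in> {0..<1}"
  define H where "H s = oriented_kernel up 1 \<beta> t s * (F s)\<^sup>2" for s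
  define S where "S = (\<integral>\<^sup>+ s. ennreal (oriented_kernel up 2 (\<beta> * p) t s * \<bar>F s\<bar> powr q) \<partial>mu)"
  have [measurable]: "H \<in> borel_measurable mu" unfolding H_def by measurable
  have shift: "H s powr p \<le> E * (oriented_kernel up 2 (\<beta> * p) t r * \<bar>F r\<bar> powr q)"
    if "0 \<le> s" "s \<le> r" "r < 1" "1 - s \<le> 2 * (1 - r)" for s r
  proof -
    have "\<bar>F s\<bar> \<le> 2 * \<bar>F r\<bar>"
      using reg[OF that] F[of s] F[of r] that by simp
    then have "\<bar>F s\<bar> powr q \<le> (2 * \<bar>F r\<bar>) powr q"
      using q by (intro powr_mono2) auto
    then have "oriented_kernel up 1 \<beta> t s powr p * \<bar>F s\<bar> powr q \<le>
        (2 powr (\<beta> * p) * oriented_kernel up 2 (\<beta> * p) t r) * (2 powr q * \<bar>F r\<bar> powr q)"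
      using that t \<beta> p
      by (intro mult_mono oriented_kernel_shift) (auto simp: powr_mult oriented_kernel_nonneg)
    moreover have "H s powr p = oriented_kernel up 1 \<beta> t s powr p * \<bar>F s\<bar> powr q"
      unfolding H_def p_def
      by (subst powr_mult) (simp_all only: square_powr_half oriented_kernel_nonneg zero_le_power2)
    ultimately show ?thesis by (simp add: E_def mult_ac)
  qed
  have ES: "ennreal E * S = (\<integral>\<^sup>+ r. ennreal E * ennreal (oriented_kernel up 2 (\<beta> * p) t r * \<bar>F r\<bar> powr q) \<partial>mu)"
    unfolding S_def by (rule nn_integral_cmult[symmetric]) measurable
  have "ennreal (((u t)\<^sup>2) powr p) \<le> ennreal (2 * E) * S"
  proof (rule powr_nn_integral_le_of_sup[where H = H and M = mu])
    fix s :: real assume "s \<in> space mu"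
    then have s: "0 \<le> s" "s < 1" by auto
    have "ennreal (H s powr p) * ennreal (1 / 2) \<le>
        ennreal (H s powr p) * (\<integral>\<^sup>+ r. indicator {s..(1 + s) / 2} r \<partial>mu)"
      using s by (intro mult_left_mono mu_right_half_interval) auto
    also have "\<dots> = (\<integral>\<^sup>+ r. ennreal (H s powr p) * indicator {s..(1 + s) / 2} r \<partial>mu)"
      by (rule nn_integral_cmult[symmetric]) (intro borel_imp_measurable_mu, measurable)
    also have "\<dots> \<le> ennreal E * S"
      unfolding ES
    proof (intro nn_integral_mono)
      fix r :: real assume "r \<in> space mu"
      then show "ennreal (H s powr p) * indicator {s..(1 + s) / 2} r \<le>
          ennreal E * ennreal (oriented_kernel up 2 (\<beta> * p) t r * \<bar>F r\<bar> powr q)"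
        using shift[of s r] s E
        by (auto simp: indicator_def ennreal_mult[symmetric] oriented_kernel_nonneg intro!: ennreal_leI)
    qed
    finally have "ennreal 2 * (ennreal (H s powr p) * ennreal (1 / 2)) \<le> ennreal 2 * (ennreal E * S)"
      by (rule mult_left_mono) simp
    moreover have "ennreal 2 * (ennreal (H s powr p) * ennreal (1 / 2)) = ennreal (H s powr p)"
    proof -
      have "ennreal 2 * (ennreal (H s powr p) * ennreal (1 / 2)) = ennreal (2 * (H s powr p * (1 / 2)))"
        by (subst ennreal_mult', simp, subst ennreal_mult', simp, rule refl)
      then show ?thesis by simp
    qed
    moreover have "ennreal 2 * (ennreal E * S) = ennreal (2 * E) * S"
      using E by (simp add: ennreal_mult mult.assoc)
    ultimately show "ennreal (H s powr p) \<le> ennreal (2 * E) * S" by simp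
  next
    have "(\<integral>\<^sup>+ s. ennreal (H s powr p) \<partial>mu) \<le> ennreal E * S"
      unfolding ES
    proof (intro nn_integral_mono)
      fix s :: real assume "s \<in> space mu"
      then show "ennreal (H s powr p) \<le>
          ennreal E * ennreal (oriented_kernel up 2 (\<beta> * p) t s * \<bar>F s\<bar> powr q)"
        using shift[of s s] E
        by (auto simp: ennreal_mult[symmetric] oriented_kernel_nonneg intro!: ennreal_leI)
    qed
    also have "\<dots> \<le> ennreal (2 * E) * S"
      using E by (intro mult_right_mono ennreal_leI) auto
    finally show "(\<integral>\<^sup>+ s. ennreal (H s powr p) \<partial>mu) \<le> ennreal (2 * E) * S" .
  next
    show "ennreal ((u t)\<^sup>2) \<le> (\<integral>\<^sup>+ s. ennreal (H s) \<partial>mu)"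
      unfolding H_def by (rule le[OF t])
  qed (use p in \<open>auto simp: H_def oriented_kernel_nonneg\<close>)
  then show "ennreal (\<bar>u t\<bar> powr q) \<le> ennreal (2 * E) *
      (\<integral>\<^sup>+ s. ennreal (oriented_kernel up 2 (\<beta> * p) t s * \<bar>F s\<bar> powr q) \<partial>mu)"
    unfolding S_def p_def by (simp only: square_powr_half)
next
  fix s :: real assume "s \<in> {0..<1}"
  then show "(\<integral>\<^sup>+ t. ennreal (oriented_kernel up 2 (\<beta> * p) t s) \<partial>mu) \<le> ennreal (2 powr (\<beta> * p) / (\<beta> * p))"
    using \<beta> q by (intro oriented_kernel_integrals(2)) (auto simp: p_def)
qed (auto simp: oriented_kernel_nonneg oriented_kernel_measurable)

text \<open>For \<open>q = \<infinity>\<close> the bounded total mass of the kernel in its second variable suffices.\<close>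

lemma hardy_infinity:
  assumes \<beta>: "0 < \<beta>"
    and [measurable]: "u \<in> borel_measurable mu" "F \<in> borel_measurable mu"
    and le: "\<And>t. t \<in> {0..<1} \<Longrightarrow>
      ennreal ((u t)\<^sup>2) \<le> (\<integral>\<^sup>+ s. ennreal (oriented_kernel up 1 \<beta> t s * (F s)\<^sup>2) \<partial>mu)"
  shows "Lq_norm mu \<infinity> u \<le> ennreal (sqrt (1 / \<beta>)) * Lq_norm mu \<infinity> F"
proof (cases "Lq_norm mu \<infinity> F")
  case top
  then show ?thesis using \<beta> by (simp add: ennreal_mult_top)
next
  case (real N)
  have "AE s in mu. ennreal \<bar>F s\<bar> \<le> ennreal N"
    using esssup_AE[of "\<lambda>s. ennreal \<bar>F s\<bar>" mu] real by (simp add: Lq_norm_def)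
  then have AE: "AE s in mu. \<bar>F s\<bar> \<le> N"
    using real by simp
  have "\<bar>u t\<bar> \<le> sqrt (1 / \<beta>) * N" if t: "t \<in> {0..<1}" for t
  proof -
    have "ennreal ((u t)\<^sup>2) \<le> (\<integral>\<^sup>+ s. ennreal (oriented_kernel up 1 \<beta> t s * (F s)\<^sup>2) \<partial>mu)"
      by (rule le[OF t])
    also have "\<dots> \<le> (\<integral>\<^sup>+ s. ennreal (N\<^sup>2) * ennreal (oriented_kernel up 1 \<beta> t s) \<partial>mu)"
    proof (rule nn_integral_mono_AE, use AE in eventually_elim)
      case (elim s)
      then have "(F s)\<^sup>2 \<le> N\<^sup>2" by (metis abs_ge_zero power2_abs power_mono)
      then have "oriented_kernel up 1 \<beta> t s * (F s)\<^sup>2 \<le> N\<^sup>2 * oriented_kernel up 1 \<beta> t s"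
        by (subst mult.commute) (intro mult_right_mono oriented_kernel_nonneg)
      then show ?case
        by (simp add: ennreal_mult[symmetric] oriented_kernel_nonneg ennreal_leI)
    qed
    also have "\<dots> = ennreal (N\<^sup>2) * (\<integral>\<^sup>+ s. ennreal (oriented_kernel up 1 \<beta> t s) \<partial>mu)"
      by (rule nn_integral_cmult) measurable
    also have "\<dots> \<le> ennreal (N\<^sup>2) * ennreal (1 / \<beta>)"
      using oriented_kernel_integrals(1)[OF \<beta>, of 1 t up] t by (intro mult_left_mono) auto
    finally have "(u t)\<^sup>2 \<le> N\<^sup>2 * (1 / \<beta>)"
      using \<beta> by (simp add: ennreal_mult[symmetric])
    then have "sqrt ((u t)\<^sup>2) \<le> sqrt (N\<^sup>2 * (1 / \<beta>))" by (rule real_sqrt_le_mono)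
    also have "sqrt (N\<^sup>2 * (1 / \<beta>)) = sqrt (1 / \<beta>) * N"
      using real by (simp only: real_sqrt_mult real_sqrt_abs abs_of_nonneg mult.commute)
    finally show ?thesis by simp
  qed
  then have "AE t in mu. ennreal \<bar>u t\<bar> \<le> ennreal (sqrt (1 / \<beta>) * N)"
    by (intro AE_I2 ennreal_leI) simp
  then have "Lq_norm mu \<infinity> u \<le> ennreal (sqrt (1 / \<beta>) * N)"
    by (auto simp: Lq_norm_def intro!: esssup_I)
  then show ?thesis using real \<beta> by (simp add: ennreal_mult)
qed

text \<open>The trace of monotonicity that survives multiplication by a power of \<open>1 - s\<close>.\<close>

definition doubling :: "(real \<Rightarrow> real) \<Rightarrow> bool" where
  "doubling F \<longleftrightarrow>
    (\<forall>s r. 0 \<le> s \<longrightarrow> s \<le> r \<longrightarrow> r < 1 \<longrightarrow> 1 - s \<le> 2 * (1 - r) \<longrightarrow> F s \<le> 2 * F r)"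

definition hardy_bound :: "bool \<Rightarrow> real \<Rightarrow> ennreal \<Rightarrow> real \<Rightarrow> bool" where
  "hardy_bound up \<beta> q C \<longleftrightarrow> (\<forall>u F.
    u \<in> borel_measurable mu \<longrightarrow> F \<in> borel_measurable mu \<longrightarrow> (\<forall>s\<in>{0..<1}. 0 \<le> F s) \<longrightarrow>
    2 \<le> q \<or> doubling F \<longrightarrow>
    (\<forall>t\<in>{0..<1}. ennreal ((u t)\<^sup>2) \<le>
      (\<integral>\<^sup>+ s. ennreal (oriented_kernel up 1 \<beta> t s * (F s)\<^sup>2) \<partial>mu)) \<longrightarrow>
    Lq_norm mu q u \<le> ennreal C * Lq_norm mu q F)"

lemma hardy_boundD:
  assumes "hardy_bound up \<beta> q C" "u \<in> borel_measurable mu" "F \<in> borel_measurable mu"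
    and "\<And>s. s \<in> {0..<1} \<Longrightarrow> 0 \<le> F s" and "2 \<le> q \<or> doubling F"
    and "\<And>t. t \<in> {0..<1} \<Longrightarrow>
      ennreal ((u t)\<^sup>2) \<le> (\<integral>\<^sup>+ s. ennreal (oriented_kernel up 1 \<beta> t s * (F s)\<^sup>2) \<partial>mu)"
  shows "Lq_norm mu q u \<le> ennreal C * Lq_norm mu q F"
  using assms unfolding hardy_bound_def by blast

lemma hardy_bound_exists:
  fixes q :: ennreal
  assumes \<beta>: "0 < \<beta>" and q: "1 \<le> q"
  shows "\<exists>C\<ge>0. hardy_bound up \<beta> q C"
proof (cases q)
  case top
  then have "q = \<infinity>" by simp
  moreover have "hardy_bound up \<beta> \<infinity> (sqrt (1 / \<beta>))"
    unfolding hardy_bound_def by (intro allI impI hardy_infinity[OF \<beta>]) blast+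
  moreover have "0 \<le> sqrt (1 / \<beta>)" using \<beta> by simp
  ultimately show ?thesis by blast
next
  case (real r)
  then have r: "1 \<le> r" using q by simp
  show ?thesis
  proof (cases "2 \<le> r")
    case True
    let ?C = "(2 * (2 * (1 / \<beta>)) powr (r / 2 - 1) * (1 / \<beta>)) powr (1 / r)"
    have "hardy_bound up \<beta> q ?C"
      unfolding hardy_bound_def real(2)
      by (intro allI impI hardy_ge_2[OF \<beta> True]) blast+
    moreover have "0 \<le> ?C" by simp
    ultimately show ?thesis by blast
  next
    case False
    then have small: "0 < r" "r < 2" "\<not> 2 \<le> ennreal r" using real r by (simp_all add: not_le)
    let ?E = "2 powr (\<beta> * (r / 2)) * 2 powr r"
    let ?C = "(2 * ?E * (2 powr (\<beta> * (r / 2)) / (\<beta> * (r / 2)))) powr (1 / r)"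
    have "hardy_bound up \<beta> q ?C"
      unfolding hardy_bound_def doubling_def real(2)
      using small by (intro allI impI hardy_less_2[OF \<beta>]) blast+
    moreover have "0 \<le> ?C" by simp
    ultimately show ?thesis by blast
  qed
qed

section \<open>Equivalence of the weighted norms\<close>

text \<open>The weights are absorbed into the kernel: pointwise, the kernel times the squared weight, divided by
  \<open>1 - s\<close>, reduces to a constant \<open>c\<close> times the indicator of the domain of integration.\<close>

lemma nn_integral_mu_eq_set_integral:
  fixes f G :: "real \<Rightarrow> real"
  assumes f: "f \<in> borel_measurable (lebesgue_on {0..<1})" and S: "S \<in> sets borel" "S \<subseteq> {0..<1}"
    and f0: "\<And>s. s \<in> {0..<1} \<Longrightarrow> 0 \<le> f s"
    and c: "0 \<le> c" and G: "G \<in> borel_measurable mu"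
    and eq: "\<And>s. s \<in> {0..<1} \<Longrightarrow> G s / (1 - s) = c * f s * indicator S s"
  shows "(\<integral>\<^sup>+ s. ennreal (G s) \<partial>mu) = ennreal c * (\<integral>\<^sup>+ s\<in>S. ennreal (f s) \<partial>lebesgue)"
proof -
  have ind: "indicator S \<in> borel_measurable (lebesgue_on {0..<1})"
    using S(1) by (intro measurable_restrict_space1 measurable_completion) simp
  have "(\<integral>\<^sup>+ s. ennreal (G s) \<partial>mu) =
      (\<integral>\<^sup>+ s. ennreal (1 / (1 - s)) * ennreal (G s) * indicator {0..<1} s \<partial>lebesgue)"
    using G by (intro nn_integral_mu) measurable
  also have "\<dots> = (\<integral>\<^sup>+ s. ennreal c * (ennreal (f s) * indicator S s) * indicator {0..<1} s \<partial>lebesgue)"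
  proof (intro nn_integral_cong)
    fix s :: real
    show "ennreal (1 / (1 - s)) * ennreal (G s) * indicator {0..<1} s =
        ennreal c * (ennreal (f s) * indicator S s) * indicator {0..<1} s"
    proof (cases "s \<in> {0..<1}")
      case True
      have "ennreal (1 / (1 - s)) * ennreal (G s) = ennreal (G s / (1 - s))"
        using True by (subst ennreal_mult'[symmetric]) auto
      also have "\<dots> = ennreal c * (ennreal (f s) * indicator S s)"
        using eq[OF True] f0[OF True] c by (auto simp: indicator_def ennreal_mult)
      finally show ?thesis by simp
    qed simp
  qed
  also have "\<dots> = (\<integral>\<^sup>+ s. ennreal c * (ennreal (f s) * indicator S s) \<partial>lebesgue_on {0..<1})"
    by (rule nn_integral_restrict_space[symmetric]) simp
  also have "\<dots> = ennreal c * (\<integral>\<^sup>+ s. ennreal (f s) * indicator S s \<partial>lebesgue_on {0..<1})"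
    using f ind by (intro nn_integral_cmult) measurable
  also have "(\<integral>\<^sup>+ s. ennreal (f s) * indicator S s \<partial>lebesgue_on {0..<1}) =
      (\<integral>\<^sup>+ s. ennreal (f s) * indicator S s * indicator {0..<1} s \<partial>lebesgue)"
    by (rule nn_integral_restrict_space) simp
  also have "\<dots> = (\<integral>\<^sup>+ s\<in>S. ennreal (f s) \<partial>lebesgue)"
    using S(2) by (intro nn_integral_cong) (auto simp: indicator_def)
  finally show ?thesis .
qed

text \<open>The truncation \<open>max 0 (x - A)\<close> isolates the part of \<open>x\<close> that the Hardy inequality has to control; the
  remaining part, at most \<open>A\<close>, is a constant function of bounded weighted norm.\<close>

lemma square_le_of_le_root:
  assumes "0 \<le> A" "0 < \<alpha>" and le: "ennreal x \<le> ennreal A + ennreal \<alpha> * ennpowr I (1 / 2)"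
  shows "ennreal ((max 0 (x - A) / \<alpha>)\<^sup>2) \<le> I"
proof (cases I)
  case (real r)
  have "ennreal x \<le> ennreal (A + \<alpha> * sqrt r)"
    using le real assms(1,2)
    by (simp add: ennpowr_ennreal powr_half_sqrt ennreal_mult[symmetric] ennreal_plus[symmetric] del: ennreal_plus)
  then have "x \<le> A + \<alpha> * sqrt r"
    using real assms by (simp del: ennreal_plus)
  then have "max 0 (x - A) \<le> \<alpha> * sqrt r"
    using real assms by simp
  then have "max 0 (x - A) / \<alpha> \<le> sqrt r"
    using assms by (simp add: field_simps)
  then have "(max 0 (x - A) / \<alpha>)\<^sup>2 \<le> (sqrt r)\<^sup>2"
    using assms by (intro power_mono) auto
  then show ?thesis using real by (simp add: ennreal_leI)
qed simp

lemma Lq_norm_weight: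
  assumes q: "1 \<le> q" and \<gamma>: "0 < \<gamma>"
  obtains B :: real where "0 \<le> B"
    and "\<And>A. 0 \<le> A \<Longrightarrow> Lq_norm mu q (\<lambda>t. (1 - t) powr \<gamma> * A) \<le> ennreal B * ennreal A"
proof (cases q)
  case top
  have "Lq_norm mu q (\<lambda>t. (1 - t) powr \<gamma> * A) \<le> ennreal 1 * ennreal A" if A: "0 \<le> A" for A
  proof -
    have "(1 - t) powr \<gamma> * A \<le> A" if "t \<in> {0..<1}" for t
      using that \<gamma> A by (intro mult_left_le_one_le powr_le1) auto
    then have "AE t in mu. ennreal \<bar>(1 - t) powr \<gamma> * A\<bar> \<le> ennreal A"
      using A by (intro AE_I2 ennreal_leI) (simp add: abs_mult)
    moreover have "(\<lambda>t. ennreal \<bar>(1 - t) powr \<gamma> * A\<bar>) \<in> borel_measurable mu"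
      by (intro borel_imp_measurable_mu) measurable
    ultimately have "esssup mu (\<lambda>t. ennreal \<bar>(1 - t) powr \<gamma> * A\<bar>) \<le> ennreal A"
      by (intro esssup_I)
    then show ?thesis by (simp add: Lq_norm_def top)
  qed
  then show ?thesis using that[of 1] by simp
next
  case (real p)
  then have p: "1 \<le> p" using q by simp
  have "Lq_norm mu q (\<lambda>t. (1 - t) powr \<gamma> * A) \<le> ennreal ((1 / (\<gamma> * p)) powr (1 / p)) * ennreal A"
    if A: "0 \<le> A" for A
  proof -
    have "(\<integral>\<^sup>+ t. ennreal (\<bar>(1 - t) powr \<gamma> * A\<bar> powr p) \<partial>mu) =
        (\<integral>\<^sup>+ t. ennreal (A powr p) * ennreal (hardy_kernel 1 (\<gamma> * p) 0 t) \<partial>mu)"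
      using A p by (intro nn_integral_cong)
        (auto simp: hardy_kernel_def abs_mult powr_mult powr_powr ennreal_mult[symmetric] mult.commute)
    also have "\<dots> = ennreal (A powr p) * (\<integral>\<^sup>+ t. ennreal (hardy_kernel 1 (\<gamma> * p) 0 t) \<partial>mu)"
      unfolding hardy_kernel_def by (intro nn_integral_cmult borel_imp_measurable_mu) measurable
    also have "\<dots> \<le> ennreal (A powr p) * ennreal (1 / (\<gamma> * p))"
      using hardy_kernel_integral_right[of "\<gamma> * p" 1 0] \<gamma> p by (intro mult_left_mono) auto
    also have "\<dots> = ennreal (A powr p * (1 / (\<gamma> * p)))"
      using \<gamma> p by (intro ennreal_mult[symmetric]) auto
    finally have "Lq_norm mu q (\<lambda>t. (1 - t) powr \<gamma> * A) \<le>
        ennpowr (ennreal (A powr p * (1 / (\<gamma> * p)))) (1 / p)"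
      using p unfolding real(2) by (subst Lq_norm_ennreal, simp, intro ennpowr_mono) auto
    also have "\<dots> = ennreal ((A powr p * (1 / (\<gamma> * p))) powr (1 / p))"
      using p \<gamma> by (intro ennpowr_ennreal) auto
    also have "(A powr p * (1 / (\<gamma> * p))) powr (1 / p) = (1 / (\<gamma> * p)) powr (1 / p) * A"
      using p \<gamma> A by (subst powr_mult) (auto simp: powr_powr)
    finally show ?thesis using A by (simp add: ennreal_mult)
  qed
  then show ?thesis using that[of "(1 / (\<gamma> * p)) powr (1 / p)"] by simp
qed

lemma weighted_mono_doubling:
  fixes f :: "real \<Rightarrow> real"
  assumes "mono_on {0..<1} f" and f0: "\<And>s. s \<in> {0..<1} \<Longrightarrow> 0 \<le> f s"
    and \<gamma>: "0 \<le> \<gamma>" "\<gamma> \<le> 1" and "0 \<le> s" "s \<le> r" "r < 1" "1 - s \<le> 2 * (1 - r)"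
  shows "(1 - s) powr \<gamma> * f s \<le> 2 * ((1 - r) powr \<gamma> * f r)"
proof -
  have "(1 - s) powr \<gamma> \<le> (2 * (1 - r)) powr \<gamma>"
    using assms by (intro powr_mono2) auto
  also have "\<dots> = 2 powr \<gamma> * (1 - r) powr \<gamma>"
    using assms by (subst powr_mult) auto
  also have "\<dots> \<le> 2 * (1 - r) powr \<gamma>"
    using \<gamma> powr_mono[of \<gamma> 1 2] by (intro mult_right_mono) auto
  finally have "(1 - s) powr \<gamma> * f s \<le> 2 * (1 - r) powr \<gamma> * f r"
    using assms by (intro mult_mono mono_onD[OF assms(1)]) auto
  then show ?thesis by (simp add: mult.assoc)
qed

text \<open>The regularity hypothesis is stated as a disjunction so that the ranges \<open>q \<ge> 2\<close> and \<open>q < 2\<close> share one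
  proof; the exponent enters only through the two Hardy constants and the norm of the weight that
  multiplies \<open>A\<close>.\<close>

lemma norm_inequalities_of_admissible:
  fixes \<alpha> \<theta> :: real and q :: ennreal
  assumes \<theta>: "0 < \<theta>" "\<theta> < 1" and \<alpha>: "0 < \<alpha>" and q: "1 \<le> q"
  shows "\<exists>c::real. 1 \<le> c \<and> (\<forall>(A::real) (d :: nat \<Rightarrow> real \<Rightarrow> real).
    0 \<le> A \<longrightarrow> admissible \<alpha> A d \<longrightarrow>
    2 \<le> q \<or> mono_on {0..<1} (d 1) \<and> mono_on {0..<1} (d 2) \<longrightarrow> norm_inequalities \<theta> q c A d)"
proof -
  obtain C1 where C1: "0 \<le> C1" and hardy1: "hardy_bound True \<theta> q C1"
    using hardy_bound_exists[OF \<theta>(1) q] by blast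
  obtain C2 where C2: "0 \<le> C2" and hardy2: "hardy_bound False (1 - \<theta>) q C2"
    using hardy_bound_exists[of "1 - \<theta>" q] \<theta> q by auto
  obtain B where B: "0 \<le> B" and weight: "\<And>A. 0 \<le> A \<Longrightarrow>
      Lq_norm mu q (\<lambda>t. (1 - t) powr ((1 - \<theta>) / 2) * A) \<le> ennreal B * ennreal A"
    using Lq_norm_weight[OF q, of "(1 - \<theta>) / 2"] \<theta> by auto
  define E where "E = 4 * (B + \<alpha> * C2)"
  define c where "c = 1 + \<alpha> + \<alpha> * C1 + \<alpha> * C1 * E"
  have E: "0 \<le> E" using B \<alpha> C2 by (simp add: E_def)
  have c: "1 \<le> c" "\<alpha> \<le> c" "\<alpha> * C1 \<le> c" "\<alpha> * C1 * E \<le> c"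
    using \<alpha> C1 E by (simp_all add: c_def)
  have "norm_inequalities \<theta> q c A d"
    if A: "0 \<le> A" and adm: "admissible \<alpha> A d"
      and mon: "2 \<le> q \<or> mono_on {0..<1} (d 1) \<and> mono_on {0..<1} (d 2)" for A d
  proof -
    define w where "w k t = (1 - t) powr ((real k - \<theta>) / 2)" for k and t :: real
    define N where "N k = wnorm \<theta> q k (d k)" for k
    have N: "N k = Lq_norm mu q (\<lambda>t. w k t * d k t)" for k
      by (simp add: N_def wnorm_def w_def)
    have d_leb: "d k \<in> borel_measurable (lebesgue_on {0..<1})" if "k \<in> {0,1,2}" for k
      using adm that by (auto simp: admissible_def)
    have d_meas: "d 0 \<in> borel_measurable mu" "d 1 \<in> borel_measurable mu" "d 2 \<in> borel_measurable mu"
      using d_leb by (simp_all add: borel_measurable_mu_iff)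
    note [measurable] = d_meas
    have w_meas [measurable]: "w k \<in> borel_measurable mu" for k
      unfolding w_def by (intro borel_imp_measurable_mu) measurable
    have wd: "(\<lambda>t. w k t * d k t) \<in> borel_measurable mu" if "k \<in> {0,1,2}" for k
      using d_leb[OF that] by (intro borel_measurable_times w_meas) (simp add: borel_measurable_mu_iff)
    have d0: "0 \<le> d k t" if "k \<in> {0,1,2}" "t \<in> {0..<1}" for k t
      using adm that by (auto simp: admissible_def)
    have w0: "0 \<le> w k t" for k t by (simp add: w_def)

    have upper: "N k \<le> ennreal \<alpha> * N 0" if k: "k \<in> {1,2}" for k
      unfolding N
    proof (rule Lq_norm_mult_le[OF q \<alpha>])
      fix t assume "t \<in> space mu"
      then have t: "t \<in> {0..<1}" by simp
      have "1 / \<alpha> * (1 - t) powr (real k / 2) * d k t \<le> d 0 t"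
        using adm t k by (auto simp: admissible_def)
      then have "(1 - t) powr (real k / 2) * d k t \<le> \<alpha> * d 0 t"
        using \<alpha> by (simp add: field_simps)
      then have "w 0 t * ((1 - t) powr (real k / 2) * d k t) \<le> w 0 t * (\<alpha> * d 0 t)"
        by (rule mult_left_mono) (rule w0)
      moreover have "w 0 t * (1 - t) powr (real k / 2) = w k t"
        using t by (simp add: w_def powr_add[symmetric] field_simps)
      ultimately have "w k t * d k t \<le> \<alpha> * (w 0 t * d 0 t)"
        by (simp add: mult_ac)
      then show "\<bar>w k t * d k t\<bar> \<le> \<alpha> * \<bar>w 0 t * d 0 t\<bar>"
        using d0[of k t] d0[of 0 t] w0[of k t] w0[of 0 t] k t by (auto simp: abs_mult)
    next
      show "(\<lambda>t. w k t * d k t) \<in> borel_measurable mu" "(\<lambda>t. w 0 t * d 0 t) \<in> borel_measurable mu"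
        using k by (auto intro!: wd simp del: One_nat_def)
    qed

    have N0: "N 0 \<le> ennreal (\<alpha> * C1) * N 1"
    proof -
      define u where "u t = w 0 t * (d 0 t / \<alpha>)" for t
      have u_meas [measurable]: "u \<in> borel_measurable mu" unfolding u_def by measurable
      have "Lq_norm mu q u \<le> ennreal C1 * Lq_norm mu q (\<lambda>t. w 1 t * d 1 t)"
      proof (rule hardy_boundD[OF hardy1])
        show "(\<lambda>t. w 1 t * d 1 t) \<in> borel_measurable mu" by measurable
        show "0 \<le> w 1 s * d 1 s" if "s \<in> {0..<1}" for s
          using that d0[of 1 s] w0 by simp
        show "2 \<le> q \<or> doubling (\<lambda>s. w 1 s * d 1 s)"
          using mon weighted_mono_doubling[of "d 1" "(1 - \<theta>) / 2"] d0[of 1] \<theta> by (auto simp: w_def doubling_def)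
      next
        fix t :: real assume t: "t \<in> {0..<1}"
        \<comment> \<open>The exponents are chosen so that all powers of \<open>1 - s\<close> cancel: \<open>\<theta> + (1 - \<theta>) - 1 = 0\<close>.\<close>
        have "(\<integral>\<^sup>+ s. ennreal (oriented_kernel True 1 \<theta> t s * (w 1 s * d 1 s)\<^sup>2) \<partial>mu) =
            ennreal ((1 - t) powr - \<theta>) * (\<integral>\<^sup>+ s\<in>{t..<1}. ennreal ((d 1 s)\<^sup>2) \<partial>lebesgue)"
        proof (rule nn_integral_mu_eq_set_integral)
          fix s :: real assume s: "s \<in> {0..<1}"
          have expand: "oriented_kernel True 1 \<theta> t s * (w 1 s * d 1 s)\<^sup>2 / (1 - s) =
              (((1 - s) / (1 - t)) powr \<theta> * (w 1 s)\<^sup>2 / (1 - s)) * (d 1 s)\<^sup>2 * indicator {t..<1} s"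
            using s by (auto simp: oriented_kernel_def hardy_kernel_def power_mult_distrib indicator_def)
          have "(w 1 s)\<^sup>2 = (1 - s) powr (1 - \<theta>)"
            using s by (simp add: w_def power2_eq_square powr_add[symmetric])
          moreover have "((1 - s) / (1 - t)) powr \<theta> * (1 - s) powr (1 - \<theta>) / (1 - s) = (1 - t) powr - \<theta>"
            using s t by (simp add: powr_divide powr_minus powr_diff field_simps)
          ultimately show "oriented_kernel True 1 \<theta> t s * (w 1 s * d 1 s)\<^sup>2 / (1 - s) =
              (1 - t) powr - \<theta> * (d 1 s)\<^sup>2 * indicator {t..<1} s"
            using expand by simp
        next
          show "(\<lambda>s. oriented_kernel True 1 \<theta> t s * (w 1 s * d 1 s)\<^sup>2) \<in> borel_measurable mu"
            by measurable
        qed (use t d_leb[of 1] in \<open>auto intro!: borel_measurable_power\<close>)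
        moreover have "ennreal ((d 0 t / \<alpha>)\<^sup>2) \<le> (\<integral>\<^sup>+ s\<in>{t..<1}. ennreal ((d 1 s)\<^sup>2) \<partial>lebesgue)"
          using square_le_of_le_root[of 0 \<alpha> "d 0 t"] adm \<alpha> t d0[of 0 t] by (auto simp: admissible_def)
        moreover have "(u t)\<^sup>2 = (1 - t) powr - \<theta> * (d 0 t / \<alpha>)\<^sup>2"
          using t by (simp add: u_def w_def power_mult_distrib power2_eq_square powr_add[symmetric])
        ultimately show "ennreal ((u t)\<^sup>2) \<le>
            (\<integral>\<^sup>+ s. ennreal (oriented_kernel True 1 \<theta> t s * (w 1 s * d 1 s)\<^sup>2) \<partial>mu)"
          by (simp add: ennreal_mult mult_left_mono)
      qed (rule u_meas)
      moreover have "N 0 \<le> ennreal \<alpha> * Lq_norm mu q u"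
        unfolding N
      proof (rule Lq_norm_mult_le[OF q \<alpha>])
        show "\<bar>w 0 t * d 0 t\<bar> \<le> \<alpha> * \<bar>u t\<bar>" for t
          using \<alpha> by (simp add: u_def abs_mult)
      qed simp_all
      ultimately have "N 0 \<le> ennreal \<alpha> * (ennreal C1 * N 1)"
        unfolding N by (meson mult_left_mono order_trans zero_le)
      then show ?thesis using \<alpha> C1 by (simp add: ennreal_mult mult.assoc)
    qed

    have N1: "N 1 \<le> ennreal E * (ennreal A + N 2)"
    proof -
      define u where "u t = w 1 t * (max 0 (d 1 t - A) / \<alpha>)" for t
      have u_meas [measurable]: "u \<in> borel_measurable mu" unfolding u_def by measurable
      have u: "Lq_norm mu q u \<le> ennreal C2 * Lq_norm mu q (\<lambda>t. w 2 t * d 2 t)"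
      proof (rule hardy_boundD[OF hardy2])
        show "(\<lambda>t. w 2 t * d 2 t) \<in> borel_measurable mu" by measurable
        show "0 \<le> w 2 s * d 2 s" if "s \<in> {0..<1}" for s
          using that d0[of 2 s] w0 by simp
        show "2 \<le> q \<or> doubling (\<lambda>s. w 2 s * d 2 s)"
          using mon weighted_mono_doubling[of "d 2" "(2 - \<theta>) / 2"] d0[of 2] \<theta> by (auto simp: w_def doubling_def)
      next
        fix t :: real assume t: "t \<in> {0..<1}"
        \<comment> \<open>Cancellation again: \<open>- (1 - \<theta>) + (2 - \<theta>) - 1 = 0\<close>.\<close>
        have "(\<integral>\<^sup>+ s. ennreal (oriented_kernel False 1 (1 - \<theta>) t s * (w 2 s * d 2 s)\<^sup>2) \<partial>mu) =
            ennreal ((1 - t) powr (1 - \<theta>)) * (\<integral>\<^sup>+ s\<in>{0..t}. ennreal ((d 2 s)\<^sup>2) \<partial>lebesgue)"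
        proof (rule nn_integral_mu_eq_set_integral)
          fix s :: real assume s: "s \<in> {0..<1}"
          have expand: "oriented_kernel False 1 (1 - \<theta>) t s * (w 2 s * d 2 s)\<^sup>2 / (1 - s) =
              (((1 - t) / (1 - s)) powr (1 - \<theta>) * (w 2 s)\<^sup>2 / (1 - s)) * (d 2 s)\<^sup>2 * indicator {0..t} s"
            using s by (auto simp: oriented_kernel_def hardy_kernel_def power_mult_distrib indicator_def)
          have "(w 2 s)\<^sup>2 = (1 - s) powr (2 - \<theta>)"
            using s by (simp add: w_def power2_eq_square powr_add[symmetric])
          moreover have "((1 - t) / (1 - s)) powr (1 - \<theta>) * (1 - s) powr (2 - \<theta>) / (1 - s) = (1 - t) powr (1 - \<theta>)"
          proof -
            have "(1 - s) powr (2 - \<theta>) = (1 - s) powr (1 - \<theta>) * (1 - s)"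
              using s powr_add[of "1 - s" "1 - \<theta>" 1] by simp
            then show ?thesis
              using s t by (simp only: powr_divide[of "1 - t" "1 - s"]) simp
          qed
          ultimately show "oriented_kernel False 1 (1 - \<theta>) t s * (w 2 s * d 2 s)\<^sup>2 / (1 - s) =
              (1 - t) powr (1 - \<theta>) * (d 2 s)\<^sup>2 * indicator {0..t} s"
            using expand by simp
        next
          show "(\<lambda>s. oriented_kernel False 1 (1 - \<theta>) t s * (w 2 s * d 2 s)\<^sup>2) \<in> borel_measurable mu"
            by measurable
        qed (use t d_leb[of 2] in \<open>auto intro!: borel_measurable_power\<close>)
        moreover have "ennreal ((max 0 (d 1 t - A) / \<alpha>)\<^sup>2) \<le> (\<integral>\<^sup>+ s\<in>{0..t}. ennreal ((d 2 s)\<^sup>2) \<partial>lebesgue)"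
          using adm t by (intro square_le_of_le_root A \<alpha>) (auto simp: admissible_def)
        moreover have "(u t)\<^sup>2 = (1 - t) powr (1 - \<theta>) * (max 0 (d 1 t - A) / \<alpha>)\<^sup>2"
          using t by (simp add: u_def w_def power_mult_distrib power2_eq_square powr_add[symmetric])
        ultimately show "ennreal ((u t)\<^sup>2) \<le>
            (\<integral>\<^sup>+ s. ennreal (oriented_kernel False 1 (1 - \<theta>) t s * (w 2 s * d 2 s)\<^sup>2) \<partial>mu)"
          by (simp add: ennreal_mult mult_left_mono)
      qed (rule u_meas)
      have "N 1 \<le> ennreal 4 * (Lq_norm mu q (\<lambda>t. w 1 t * A) + Lq_norm mu q (\<lambda>t. \<alpha> * u t))"
        unfolding N
      proof (rule Lq_norm_add_le[OF q])
        fix t assume "t \<in> space mu"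
        then have "0 \<le> d 1 t" using d0[of 1 t] by simp
        then have "w 1 t * d 1 t \<le> w 1 t * (A + max 0 (d 1 t - A))" "0 \<le> w 1 t * d 1 t"
          using w0[of 1 t] by (auto intro!: mult_left_mono)
        moreover have "\<alpha> * u t = w 1 t * max 0 (d 1 t - A)"
          using \<alpha> by (simp add: u_def)
        ultimately show "\<bar>w 1 t * d 1 t\<bar> \<le> \<bar>w 1 t * A\<bar> + \<bar>\<alpha> * u t\<bar>"
          using A w0[of 1 t] by (simp add: distrib_left)
      qed (simp_all del: One_nat_def)
      also have "\<dots> \<le> ennreal 4 * (ennreal B * ennreal A + ennreal \<alpha> * (ennreal C2 * N 2))"
      proof (intro mult_left_mono add_mono)
        show "Lq_norm mu q (\<lambda>t. w 1 t * A) \<le> ennreal B * ennreal A"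
          using weight[OF A] by (simp add: w_def)
        have "Lq_norm mu q (\<lambda>t. \<alpha> * u t) \<le> ennreal \<alpha> * Lq_norm mu q u"
          using \<alpha> by (intro Lq_norm_mult_le q) (auto simp: abs_mult)
        also have "\<dots> \<le> ennreal \<alpha> * (ennreal C2 * N 2)"
          unfolding N by (intro mult_left_mono u) auto
        finally show "Lq_norm mu q (\<lambda>t. \<alpha> * u t) \<le> ennreal \<alpha> * (ennreal C2 * N 2)" .
      qed auto
      also have "\<dots> \<le> ennreal 4 * (ennreal (B + \<alpha> * C2) * ennreal A + ennreal (B + \<alpha> * C2) * N 2)"
        using B \<alpha> C2
        by (intro mult_left_mono add_mono)
          (auto simp: mult.assoc[symmetric] ennreal_mult[symmetric] simp del: ennreal_plus intro!: mult_right_mono ennreal_leI)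
      also have "\<dots> = ennreal E * (ennreal A + N 2)"
      proof -
        have "ennreal E = ennreal 4 * ennreal (B + \<alpha> * C2)"
          unfolding E_def using B \<alpha> C2 by (intro ennreal_mult) auto
        then show ?thesis by (simp only: distrib_left mult.assoc)
      qed
      finally show ?thesis .
    qed

    have lift: "X \<le> ennreal c * Y" if "X \<le> ennreal b * Y" "b \<le> c" for b X Y
      using that by (meson ennreal_leI mult_right_mono order_trans zero_le)
    have "N 0 \<le> ennreal (\<alpha> * C1) * (ennreal E * (ennreal A + N 2))"
      using N0 N1 by (meson mult_left_mono order_trans zero_le)
    then have "N 0 \<le> ennreal (\<alpha> * C1 * E) * (ennreal A + N 2)"
      using \<alpha> C1 E by (simp add: ennreal_mult mult.assoc)
    then have "N 0 \<le> ennreal c * (ennreal A + N 2)"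
      using c by (rule_tac lift)
    then have "ennreal c * N 0 \<le> ennreal c * (ennreal c * (ennreal A + N 2))"
      by (rule mult_left_mono) simp
    also have "\<dots> = ennreal (c\<^sup>2) * (ennreal A + N 2)"
      using c by (simp add: power2_eq_square ennreal_mult mult.assoc)
    finally have last: "ennreal c * N 0 \<le> ennreal (c\<^sup>2) * (ennreal A + N 2)" .
    have "N 0 \<le> ennreal c * N 1" using N0 c by (rule_tac lift)
    then have "ennreal (1 / c) * N 0 \<le> ennreal (1 / c) * (ennreal c * N 1)"
      by (rule mult_left_mono) simp
    also have "\<dots> = N 1"
      using c by (simp add: mult.assoc[symmetric] ennreal_mult[symmetric])
    finally have "ennreal (1 / c) * N 0 \<le> N 1" .
    moreover have "N 1 \<le> ennreal c * N 0" "N 2 \<le> ennreal c * N 0"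
      using lift[OF upper c(2)] by auto
    ultimately show ?thesis
      using last by (simp add: norm_inequalities_def N_def)
  qed
  with c(1) show ?thesis by blast
qed

theorem propositionA4:
  fixes \<alpha> \<theta> :: real and q :: ennreal
  assumes "0 < \<theta>" and "\<theta> < 1" and "0 < \<alpha>"
  shows "(2 \<le> q \<longrightarrow>
           (\<exists>c::real. 1 \<le> c \<and>
             (\<forall>(A::real) (d :: nat \<Rightarrow> real \<Rightarrow> real).
                0 \<le> A \<longrightarrow> admissible \<alpha> A d \<longrightarrow> norm_inequalities \<theta> q c A d))) \<and>
         (1 \<le> q \<and> q < 2 \<longrightarrow>
           (\<exists>c::real. 1 \<le> c \<and>
             (\<forall>(A::real) (d :: nat \<Rightarrow> real \<Rightarrow> real).
                0 \<le> A \<longrightarrow> admissible \<alpha> A d \<longrightarrow>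
                mono_on {0..<1} (d 1) \<longrightarrow> mono_on {0..<1} (d 2) \<longrightarrow>
                norm_inequalities \<theta> q c A d)))"
proof -
  have "1 \<le> q" if "2 \<le> q"
    using that by (rule order_trans[rotated]) simp
  then show ?thesis
    using norm_inequalities_of_admissible[OF assms, of q] by blast
qed

end
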